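(* Let $\mathbb{E}$ be a (finite-dimensional) Euclidean space, $f\in\Gamma_0(\mathbb{E})$ and $\bar x\in\mathbb{E}$. Then $$\lim_{\lambda\downarrow0,\ x\to\bar x}P_\lambda f(x)=P_{\mathrm{cl}(\mathrm{dom} f)}(\bar x).$$
   Context: $\Gamma_0(\mathbb{E})$ denotes the closed proper convex functions $\mathbb{E}\to\mathbb{R}\cup\{+\infty\}$. For $\lambda>0$, $P_\lambda f(x)=\mathrm{argmin}_{u\in\mathbb{E}}\{f(u)+\frac1{2\lambda}\|x-u\|^2\}$ is the proximal map. $P_C$ is the Euclidean projection onto a closed convex set $C$. *)

theory Defs
  imports "HOL-Analysis.Analysis"
begin

text \<open>
  Extended-real-valued functions are modelled with values in \<^typ>\<open>ereal\<close>; properness excludes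
  the value \<open>-\<infinity>\<close>. The library constant \<^const>\<open>epigraph\<close> is restricted to real-valued functions.
\<close>

definition ereal_epi :: "('a \<Rightarrow> ereal) \<Rightarrow> ('a \<times> real) set" where
  "ereal_epi f = {(x, r). f x \<le> ereal r}"

definition ereal_dom :: "('a \<Rightarrow> ereal) \<Rightarrow> 'a set" where
  "ereal_dom f = {x. f x < \<infinity>}"

definition ereal_proper :: "('a \<Rightarrow> ereal) \<Rightarrow> bool" where
  "ereal_proper f \<longleftrightarrow> (\<forall>x. f x \<noteq> -\<infinity>) \<and> ereal_dom f \<noteq> {}"

definition Gamma0 :: "('a::euclidean_space \<Rightarrow> ereal) set" where
  "Gamma0 = {f. ereal_proper f \<and> convex (ereal_epi f) \<and> closed (ereal_epi f)}"

text \<open>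
  The argmin is identified with its unique element, hence the definite description: \<open>prox\<close> is only
  meaningful where the minimiser exists and is unique, as it does for \<open>lam > 0\<close> and \<open>f \<in> Gamma0\<close>.
\<close>

definition prox :: "real \<Rightarrow> ('a::euclidean_space \<Rightarrow> ereal) \<Rightarrow> 'a \<Rightarrow> 'a" where
  "prox lam f x =
     (THE u. is_arg_min (\<lambda>u. f u + ereal (1 / (2 * lam) * (norm (x - u))\<^sup>2)) (\<lambda>_. True) u)"

end

theory Submission
  imports Defs
begin

text \<open>
  Write \<open>p\<close> for the proximal point, \<open>C\<close> for the closure of the domain, and \<open>q\<close> for the projection
  of \<open>xbar\<close> onto \<open>C\<close>. The argument is a single quantitative estimate, with no passage to
  subsequences.

  Separating the epigraph from a point below it yields an affine minorant of \<open>f\<close>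
  (\<open>Gamma0_affine_minorant\<close>). The minorant makes \<open>f + |x - \<cdot>|\<^sup>2 / (2 \<lambda>)\<close> coercive, so a minimiser exists
  (\<open>prox_objective_has_minimiser\<close>). Convexity of \<open>f\<close> along the segment from a minimiser \<open>p\<close> to any
  \<open>u\<close> in the domain gives the variational inequality
  \<open>\<langle>x - p, u - p\<rangle> \<le> \<lambda> (f u - f p)\<close> (\<open>prox_minimiser_variational_inequality\<close>), and hence uniqueness.

  For the limit, \<open>|u - p|\<^sup>2 = \<langle>x - p, u - p\<rangle> + \<langle>u - x, u - p\<rangle>\<close>. The first term is bounded by the
  variational inequality, with \<open>f p\<close> bounded below by the affine minorant; in the second, the part
  \<open>\<langle>q - xbar, q - p\<rangle>\<close> is nonpositive, because \<open>p\<close> lies in \<open>C\<close> and \<open>q\<close> is a projection. This gives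
  \<open>d\<^sup>2 \<le> A d + B\<close> for \<open>d = |u - p|\<close> (\<open>prox_distance_estimate\<close>), where \<open>A\<close> and \<open>B\<close> become small if
  \<open>u\<close> is first chosen in the domain close to \<open>q\<close>, and then \<open>\<lambda>\<close> close to \<open>0\<close> and \<open>x\<close> close to \<open>xbar\<close>.
\<close>

section \<open>A quadratic inequality; domain and affine minorants of closed proper convex functions\<close>

lemma quadratic_inequality_bound:
  fixes d A B :: real
  assumes "d\<^sup>2 \<le> A * d + B" "0 \<le> A" "0 \<le> B"
  shows "d \<le> A + sqrt B"
proof (rule ccontr)
  assume "\<not> d \<le> A + sqrt B"
  then have *: "d - A > sqrt B" "d > sqrt B" using assms(2) by auto
  have "sqrt B * sqrt B < (d - A) * d"
    by (rule mult_strict_mono'[OF *]) (use assms in auto)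
  then show False using assms by (simp add: power2_eq_square algebra_simps)
qed

lemma Gamma0_real_of_ereal:
  assumes "f \<in> Gamma0" "u \<in> ereal_dom f"
  shows "f u = ereal (real_of_ereal (f u))"
  using assms by (auto simp: Gamma0_def ereal_proper_def ereal_dom_def ereal_real)

lemma ereal_dom_eq_fst_epi:
  assumes "f \<in> Gamma0"
  shows "ereal_dom f = fst ` ereal_epi f"
proof
  show "ereal_dom f \<subseteq> fst ` ereal_epi f"
  proof
    fix u assume "u \<in> ereal_dom f"
    then have "(u, real_of_ereal (f u)) \<in> ereal_epi f"
      using Gamma0_real_of_ereal[OF assms] by (simp add: ereal_epi_def)
    then show "u \<in> fst ` ereal_epi f" by force
  qed
  show "fst ` ereal_epi f \<subseteq> ereal_dom f"
    by (auto simp: ereal_epi_def ereal_dom_def intro: le_less_trans)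
qed

lemma convex_ereal_dom:
  assumes "f \<in> Gamma0"
  shows "convex (ereal_dom f)"
  unfolding ereal_dom_eq_fst_epi[OF assms]
  using assms by (intro convex_linear_image linear_fst) (simp add: Gamma0_def)

lemma Gamma0_affine_minorant:
  fixes f :: "'a::euclidean_space \<Rightarrow> ereal"
  assumes f: "f \<in> Gamma0"
  obtains a b where "\<And>u. ereal (inner a u + b) \<le> f u"
proof -
  obtain x0 where x0: "x0 \<in> ereal_dom f"
    using f by (auto simp: Gamma0_def ereal_proper_def)
  define r0 where "r0 = real_of_ereal (f x0)"
  have fx0: "f x0 = ereal r0"
    using Gamma0_real_of_ereal[OF f x0] by (simp add: r0_def)
  have "(x0, r0 - 1) \<notin> ereal_epi f" by (simp add: ereal_epi_def fx0)
  then obtain w b where wb: "inner w (x0, r0 - 1) < b" "\<And>z. z \<in> ereal_epi f \<Longrightarrow> inner w z > b"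
    using separating_hyperplane_closed_point[of "ereal_epi f" "(x0, r0 - 1)"] f
    unfolding Gamma0_def by blast
  obtain a s where w: "w = (a, s)" by force
  \<comment> \<open>Comparing \<open>(x0, r0 - 1)\<close> with \<open>(x0, r0)\<close> shows that the separating hyperplane is not vertical.\<close>
  have "(x0, r0) \<in> ereal_epi f" by (simp add: ereal_epi_def fx0)
  from wb(2)[OF this] wb(1) have s: "s > 0"
    by (simp add: w inner_Pair algebra_simps)
  have "ereal (inner (- (1 / s) *\<^sub>R a) u + b / s) \<le> f u" for u
  proof (cases "u \<in> ereal_dom f")
    case True
    note fu = Gamma0_real_of_ereal[OF f True]
    have "(u, real_of_ereal (f u)) \<in> ereal_epi f" using fu by (simp add: ereal_epi_def)
    from wb(2)[OF this] have "b < inner a u + s * real_of_ereal (f u)"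
      by (simp add: w inner_Pair)
    then have "inner (- (1 / s) *\<^sub>R a) u + b / s \<le> real_of_ereal (f u)"
      using s by (simp add: field_simps)
    then show ?thesis by (subst fu) simp
  qed (simp add: ereal_dom_def)
  then show ?thesis by (rule that)
qed

section \<open>Existence, uniqueness and variational inequality of the proximal point\<close>

lemma prox_minimiser_in_dom:
  fixes f :: "'a::euclidean_space \<Rightarrow> ereal"
  assumes f: "f \<in> Gamma0"
    and p: "is_arg_min (\<lambda>u. f u + ereal (k * (norm (x - u))\<^sup>2)) (\<lambda>_. True) p"
  shows "p \<in> ereal_dom f"
proof (rule ccontr)
  assume "p \<notin> ereal_dom f"
  then have inf: "f p = \<infinity>" by (simp add: ereal_dom_def)
  obtain x0 where x0: "x0 \<in> ereal_dom f"
    using f by (auto simp: Gamma0_def ereal_proper_def)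
  have "f x0 + ereal (k * (norm (x - x0))\<^sup>2) < f p + ereal (k * (norm (x - p))\<^sup>2)"
    by (subst Gamma0_real_of_ereal[OF f x0]) (simp add: inf)
  with p show False by (auto simp: is_arg_min_def)
qed

text \<open>
  Minimising over the epigraph turns lower semicontinuity into closedness: the sublevel set
  \<open>S\<close> is compact, and the objective \<open>r + k |x - u|\<^sup>2\<close> is continuous on it.
\<close>
lemma prox_objective_has_minimiser:
  fixes f :: "'a::euclidean_space \<Rightarrow> ereal"
  assumes f: "f \<in> Gamma0" and k: "k > 0"
  obtains p where "is_arg_min (\<lambda>u. f u + ereal (k * (norm (x - u))\<^sup>2)) (\<lambda>_. True) p"
proof -
  obtain x0 where x0: "x0 \<in> ereal_dom f"
    using f by (auto simp: Gamma0_def ereal_proper_def)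
  define h where "h = (\<lambda>z::'a \<times> real. snd z + k * (norm (x - fst z))\<^sup>2)"
  define z0 where "z0 = (x0, real_of_ereal (f x0))"
  define S where "S = ereal_epi f \<inter> {z. h z \<le> h z0}"
  have cont: "continuous_on T h" for T
    unfolding h_def by (intro continuous_intros)
  have "closed {z. h z \<le> h z0}"
    by (intro closed_Collect_le cont continuous_on_const)
  then have "closed S" using f by (auto simp: S_def Gamma0_def)
  have z0: "z0 \<in> S"
    using Gamma0_real_of_ereal[OF f x0] by (simp add: S_def z0_def ereal_epi_def)
  obtain a b where ab: "\<And>u. ereal (inner a u + b) \<le> f u"
    using Gamma0_affine_minorant[OF f] by blast
  define M where "M = \<bar>h z0 - b - inner a x\<bar>"
  define R where "R = norm a / k + sqrt (M / k)"
  define L where "L = \<bar>b\<bar> + norm a * (norm x + R)"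
  have "S \<subseteq> cball x R \<times> {- L .. h z0}"
  proof (rule subrelI)
    fix u r assume "(u, r) \<in> S"
    then have fr: "f u \<le> ereal r" and hr: "r + k * (norm (x - u))\<^sup>2 \<le> h z0"
      by (auto simp: S_def ereal_epi_def h_def)
    have "ereal (inner a u + b) \<le> ereal r" using ab fr by (rule order_trans)
    then have r: "inner a u + b \<le> r" by simp
    have "inner a (x - u) \<le> norm a * norm (x - u)" by (rule norm_cauchy_schwarz)
    then have "k * (norm (x - u))\<^sup>2 \<le> norm a * norm (x - u) + M"
      using hr r by (simp add: M_def inner_diff_right)
    then have "(norm (x - u))\<^sup>2 \<le> norm a / k * norm (x - u) + M / k"
      using k by (simp add: field_simps)
    then have xu: "norm (x - u) \<le> R"
      unfolding R_def by (rule quadratic_inequality_bound) (use k in \<open>auto simp: M_def\<close>)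
    have "norm u \<le> norm x + R"
      using xu norm_triangle_sub[of u x] by (simp add: norm_minus_commute)
    then have "norm a * norm u \<le> norm a * (norm x + R)"
      by (intro mult_left_mono) auto
    moreover have "- inner a u \<le> norm a * norm u"
      using norm_cauchy_schwarz[of "- a" u] by simp
    ultimately have "- L \<le> r" using r by (simp add: L_def)
    moreover have "r \<le> h z0" using hr k by (smt (verit) mult_nonneg_nonneg zero_le_power2)
    ultimately show "(u, r) \<in> cball x R \<times> {- L .. h z0}" using xu by (simp add: dist_norm)
  qed
  then have "bounded S"
    by (rule bounded_subset[rotated]) (intro bounded_Times bounded_cball bounded_closed_interval)
  with \<open>closed S\<close> have "compact S" by (simp add: compact_eq_bounded_closed)
  then obtain z where z: "z \<in> S" and zmin: "\<And>y. y \<in> S \<Longrightarrow> h z \<le> h y"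
    using continuous_attains_inf[of S h] z0 cont by blast
  obtain p r where pr: "z = (p, r)" by force
  have "\<not> (f u + ereal (k * (norm (x - u))\<^sup>2) < f p + ereal (k * (norm (x - p))\<^sup>2))" for u
  proof
    assume lt: "f u + ereal (k * (norm (x - u))\<^sup>2) < f p + ereal (k * (norm (x - p))\<^sup>2)"
    then have "u \<in> ereal_dom f" by (cases "f u") (auto simp: ereal_dom_def)
    note fu = Gamma0_real_of_ereal[OF f this]
    have "f p \<le> ereal r" using z by (simp add: S_def ereal_epi_def pr)
    then have "f p + ereal (k * (norm (x - p))\<^sup>2) \<le> ereal r + ereal (k * (norm (x - p))\<^sup>2)"
      by (rule add_right_mono)
    with lt have "f u + ereal (k * (norm (x - u))\<^sup>2) < ereal (h z)"
      by (simp add: h_def pr)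
    then have less: "h (u, real_of_ereal (f u)) < h z"
      by (subst (asm) fu) (simp add: h_def)
    moreover have "h z \<le> h z0" using z by (simp add: S_def)
    ultimately have "(u, real_of_ereal (f u)) \<in> S"
      using fu by (simp add: S_def ereal_epi_def)
    from zmin[OF this] less show False by simp
  qed
  then show ?thesis by (intro that[of p]) (simp add: is_arg_min_def)
qed

lemma prox_minimiser_variational_inequality:
  fixes f :: "'a::euclidean_space \<Rightarrow> ereal"
  assumes f: "f \<in> Gamma0" and k: "k > 0"
    and p: "is_arg_min (\<lambda>u. f u + ereal (k * (norm (x - u))\<^sup>2)) (\<lambda>_. True) p"
    and u: "u \<in> ereal_dom f"
  shows "2 * k * inner (x - p) (u - p) \<le> real_of_ereal (f u) - real_of_ereal (f p)"
proof -
  define A where "A = 2 * k * inner (x - p) (u - p) - (real_of_ereal (f u) - real_of_ereal (f p))"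
  define B where "B = k * (norm (u - p))\<^sup>2"
  have B: "B \<ge> 0" using k by (simp add: B_def)
  note fu = Gamma0_real_of_ereal[OF f u]
  note fp = Gamma0_real_of_ereal[OF f prox_minimiser_in_dom[OF f p]]
  \<comment> \<open>Minimality of \<open>p\<close> against the point at parameter \<open>t\<close> on the segment from \<open>p\<close> to \<open>u\<close>.\<close>
  have key: "A \<le> t * B" if t: "0 < t" "t \<le> 1" for t
  proof -
    define v where "v = (1 - t) *\<^sub>R p + t *\<^sub>R u"
    define s where "s = (1 - t) * real_of_ereal (f p) + t * real_of_ereal (f u)"
    have "(p, real_of_ereal (f p)) \<in> ereal_epi f" "(u, real_of_ereal (f u)) \<in> ereal_epi f"
      using fu fp by (simp_all add: ereal_epi_def)
    moreover have "convex (ereal_epi f)" using f by (simp add: Gamma0_def)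
    ultimately have "(1 - t) *\<^sub>R (p, real_of_ereal (f p)) + t *\<^sub>R (u, real_of_ereal (f u)) \<in> ereal_epi f"
      using t by (intro convexD) auto
    then have fv: "f v \<le> ereal s" by (simp add: ereal_epi_def v_def s_def)
    have "f p + ereal (k * (norm (x - p))\<^sup>2) \<le> f v + ereal (k * (norm (x - v))\<^sup>2)"
      using p by (simp add: is_arg_min_def not_less)
    also have "\<dots> \<le> ereal s + ereal (k * (norm (x - v))\<^sup>2)"
      using fv by (rule add_right_mono)
    finally have le: "real_of_ereal (f p) + k * (norm (x - p))\<^sup>2 \<le> s + k * (norm (x - v))\<^sup>2"
      by (subst (asm) fp) simp
    have xv: "x - v = (x - p) - t *\<^sub>R (u - p)" by (simp add: v_def algebra_simps)
    have "(norm (x - v))\<^sup>2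
        = (norm (x - p))\<^sup>2 - 2 * t * inner (x - p) (u - p) + t\<^sup>2 * (norm (u - p))\<^sup>2"
      unfolding xv
      unfolding power2_norm_eq_inner
      by (simp add: power2_eq_square algebra_simps inner_commute)
    with le have "real_of_ereal (f p) - s \<le> - 2 * k * t * inner (x - p) (u - p) + k * t\<^sup>2 * (norm (u - p))\<^sup>2"
      by (simp add: distrib_left right_diff_distrib)
    then have "t * A \<le> t * (t * B)"
      unfolding A_def B_def s_def
      by (simp only: left_diff_distrib right_diff_distrib power2_eq_square mult_ac)
    then show ?thesis using t by simp
  qed
  have "A \<le> 0"
  proof (rule ccontr)
    assume "\<not> A \<le> 0"
    define t where "t = min 1 (A / (2 * (B + 1)))"
    have t: "0 < t" "t \<le> 1" using \<open>\<not> A \<le> 0\<close> B by (auto simp: t_def)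
    have "t \<le> A / (2 * (B + 1))" by (simp add: t_def)
    then have "2 * (t * B) + 2 * t \<le> A" using B by (simp add: field_simps)
    with key[OF t] t \<open>\<not> A \<le> 0\<close> B show False
      by (smt (verit) mult_nonneg_nonneg)
  qed
  then show ?thesis by (simp add: A_def)
qed

lemma prox_minimiser_unique:
  fixes f :: "'a::euclidean_space \<Rightarrow> ereal"
  assumes f: "f \<in> Gamma0" and k: "k > 0"
    and p: "is_arg_min (\<lambda>u. f u + ereal (k * (norm (x - u))\<^sup>2)) (\<lambda>_. True) p"
    and q: "is_arg_min (\<lambda>u. f u + ereal (k * (norm (x - u))\<^sup>2)) (\<lambda>_. True) q"
  shows "p = q"
proof -
  have "2 * k * inner (x - p) (q - p) + 2 * k * inner (x - q) (p - q) \<le> 0"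
    using prox_minimiser_variational_inequality[OF f k p prox_minimiser_in_dom[OF f q]]
      prox_minimiser_variational_inequality[OF f k q prox_minimiser_in_dom[OF f p]] by linarith
  also have "2 * k * inner (x - p) (q - p) + 2 * k * inner (x - q) (p - q)
      = 2 * k * inner (p - q) (p - q)"
    by (simp add: algebra_simps inner_commute)
  finally have "inner (p - q) (p - q) \<le> 0" using k by (simp add: mult_le_0_iff)
  then show ?thesis
    using inner_ge_zero[of "p - q"] by (metis antisym eq_iff_diff_eq_0 inner_eq_zero_iff)
qed

lemma prox_is_arg_min:
  fixes f :: "'a::euclidean_space \<Rightarrow> ereal"
  assumes f: "f \<in> Gamma0" and lam: "lam > 0"
  shows "is_arg_min (\<lambda>u. f u + ereal (1 / (2 * lam) * (norm (x - u))\<^sup>2)) (\<lambda>_. True) (prox lam f x)"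
proof -
  have k: "1 / (2 * lam) > 0" using lam by simp
  obtain p where p: "is_arg_min (\<lambda>u. f u + ereal (1 / (2 * lam) * (norm (x - u))\<^sup>2)) (\<lambda>_. True) p"
    using prox_objective_has_minimiser[OF f k] .
  show ?thesis
    unfolding prox_def by (rule theI[where a = p]) (use p prox_minimiser_unique[OF f k _ p] in blast)+
qed

lemma prox_in_dom:
  fixes f :: "'a::euclidean_space \<Rightarrow> ereal"
  assumes "f \<in> Gamma0" "lam > 0"
  shows "prox lam f x \<in> ereal_dom f"
  using prox_minimiser_in_dom[OF assms(1) prox_is_arg_min[OF assms]] .

lemma prox_variational_inequality:
  fixes f :: "'a::euclidean_space \<Rightarrow> ereal"
  assumes f: "f \<in> Gamma0" and lam: "lam > 0" and u: "u \<in> ereal_dom f"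
  shows "inner (x - prox lam f x) (u - prox lam f x)
    \<le> lam * (real_of_ereal (f u) - real_of_ereal (f (prox lam f x)))"
proof -
  have k: "1 / (2 * lam) > 0" using lam by simp
  show ?thesis
    using prox_minimiser_variational_inequality[OF f k prox_is_arg_min[OF f lam] u, of x] lam
    by (simp add: field_simps)
qed

section \<open>Convergence to the projection\<close>

lemma prox_distance_estimate:
  fixes f :: "'a::euclidean_space \<Rightarrow> ereal" and xbar :: 'a
  assumes f: "f \<in> Gamma0" and lam: "lam > 0" and u: "u \<in> ereal_dom f"
    and minorant: "\<And>v. ereal (inner a v + b) \<le> f v"
  defines "q \<equiv> closest_point (closure (ereal_dom f)) xbar"
  shows "(norm (u - prox lam f x))\<^sup>2
    \<le> (lam * norm a + norm (u - q) + norm (x - xbar)) * norm (u - prox lam f x)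
      + (lam * \<bar>real_of_ereal (f u) - inner a u - b\<bar> + norm (q - xbar) * norm (u - q))"
proof -
  define p where "p = prox lam f x"
  define d where "d = norm (u - p)"
  have pdom: "p \<in> ereal_dom f" unfolding p_def using f lam by (rule prox_in_dom)
  have "p \<in> closure (ereal_dom f)" using pdom closure_subset by blast
  then have proj: "inner (xbar - q) (p - q) \<le> 0"
    unfolding q_def
    by (intro closest_point_dot convex_closure convex_ereal_dom f closed_closure)
  have "ereal (inner a p + b) \<le> ereal (real_of_ereal (f p))"
    using minorant[of p] Gamma0_real_of_ereal[OF f pdom] by simp
  then have fp: "inner a p + b \<le> real_of_ereal (f p)" by simp
  have "inner a (u - p) \<le> norm a * d" unfolding d_def by (rule norm_cauchy_schwarz)
  then have "real_of_ereal (f u) - real_of_ereal (f p)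
      \<le> \<bar>real_of_ereal (f u) - inner a u - b\<bar> + norm a * d"
    using fp by (simp add: inner_diff_right)
  then have "lam * (real_of_ereal (f u) - real_of_ereal (f p))
      \<le> lam * (\<bar>real_of_ereal (f u) - inner a u - b\<bar> + norm a * d)"
    using lam by (intro mult_left_mono) auto
  with prox_variational_inequality[OF f lam u, of x]
  have 1: "inner (x - p) (u - p) \<le> lam * \<bar>real_of_ereal (f u) - inner a u - b\<bar> + lam * norm a * d"
    by (simp add: p_def algebra_simps)
  have 2: "inner (u - q) (u - p) \<le> norm (u - q) * d"
    unfolding d_def by (rule norm_cauchy_schwarz)
  have 3: "inner (xbar - x) (u - p) \<le> norm (x - xbar) * d"
    unfolding d_def using norm_cauchy_schwarz[of "xbar - x" "u - p"]
    by (simp add: norm_minus_commute)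
  have 4: "inner (q - xbar) (u - q) \<le> norm (q - xbar) * norm (u - q)"
    by (rule norm_cauchy_schwarz)
  have "d\<^sup>2 = inner (x - p) (u - p) + inner (u - q) (u - p) + inner (xbar - x) (u - p)
      + inner (q - xbar) (u - q) + inner (xbar - q) (p - q)"
    by (simp add: d_def power2_norm_eq_inner algebra_simps inner_commute)
  with 1 2 3 4 proj show ?thesis
    by (simp add: d_def p_def algebra_simps)
qed

theorem proposition5:
  fixes f :: "'a::euclidean_space \<Rightarrow> ereal" and xbar :: 'a
  assumes "f \<in> Gamma0"
  shows "((\<lambda>(lam, x). prox lam f x) \<longlongrightarrow> closest_point (closure (ereal_dom f)) xbar)
           (at_right 0 \<times>\<^sub>F nhds xbar)"
proof (rule tendstoI)
  fix e :: real assume e: "e > 0"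
  note f = assms
  define q where "q = closest_point (closure (ereal_dom f)) xbar"
  define e' where "e' = e / 4"
  have e': "e' > 0" using e by (simp add: e'_def)
  have "ereal_dom f \<noteq> {}" using f by (auto simp: Gamma0_def ereal_proper_def)
  then have q: "q \<in> closure (ereal_dom f)"
    unfolding q_def by (intro closest_point_in_set) auto
  obtain a b where ab: "\<And>u. ereal (inner a u + b) \<le> f u"
    using Gamma0_affine_minorant[OF f] by blast
  \<comment> \<open>The point \<open>u\<close> is fixed before \<open>lam\<close>, since \<open>f u\<close> may blow up as \<open>u\<close> approaches \<open>q\<close>.\<close>
  define r where "r = min (e' / 3) (e'\<^sup>2 / (2 * (norm (q - xbar) + 1)))"
  have r: "r > 0" using e' by (simp add: r_def add_nonneg_pos)
  obtain u where u: "u \<in> ereal_dom f" and "dist u q < r"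
    using q r unfolding closure_approachable by blast
  then have ur: "norm (u - q) < r" by (simp add: dist_norm)
  define K where "K = \<bar>real_of_ereal (f u) - inner a u - b\<bar>"
  have uq1: "norm (u - q) < e' / 3" using ur by (simp add: r_def)
  have "norm (u - q) < e'\<^sup>2 / (2 * (norm (q - xbar) + 1))" using ur by (simp add: r_def)
  then have "norm (u - q) * (2 * (norm (q - xbar) + 1)) < e'\<^sup>2"
    by (subst (asm) pos_less_divide_eq) (auto intro: add_nonneg_pos)
  then have uq2: "norm (q - xbar) * norm (u - q) \<le> e'\<^sup>2 / 2"
    using norm_ge_zero[of "u - q"] by (simp add: algebra_simps del: norm_ge_zero)
  have "((\<lambda>lam. lam * norm a) \<longlongrightarrow> 0 * norm a) (at_right 0)"
    by (intro tendsto_intros)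
  then have ev1: "eventually (\<lambda>lam. lam * norm a < e' / 3) (at_right 0)"
    by (rule order_tendstoD) (use e' in simp)
  have "((\<lambda>lam. lam * K) \<longlongrightarrow> 0 * K) (at_right 0)"
    by (intro tendsto_intros)
  then have ev2: "eventually (\<lambda>lam. lam * K < e'\<^sup>2 / 2) (at_right 0)"
    by (rule order_tendstoD) (use e' in simp)
  have ev3: "eventually (\<lambda>lam::real. lam > 0) (at_right 0)"
    by (rule eventually_at_right_less)
  have evl: "eventually (\<lambda>lam. lam > 0 \<and> lam * norm a < e' / 3 \<and> lam * K < e'\<^sup>2 / 2) (at_right 0)"
    using ev1 ev2 ev3 by eventually_elim auto
  have evx: "eventually (\<lambda>x. dist x xbar < e' / 3) (nhds xbar)"
    using e' by (intro eventually_nhds_ball[of "e' / 3" xbar, THEN eventually_mono]) 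
      (auto simp: dist_commute)
  have close: "dist (prox lam f x) q < e"
    if lam: "lam > 0 \<and> lam * norm a < e' / 3 \<and> lam * K < e'\<^sup>2 / 2" and x: "dist x xbar < e' / 3"
    for lam x
  proof -
    define A where "A = lam * norm a + norm (u - q) + norm (x - xbar)"
    define B where "B = lam * K + norm (q - xbar) * norm (u - q)"
    have "(norm (u - prox lam f x))\<^sup>2 \<le> A * norm (u - prox lam f x) + B"
      unfolding A_def B_def K_def q_def
      by (rule prox_distance_estimate) (use f lam u ab in auto)
    then have "norm (u - prox lam f x) \<le> A + sqrt B"
      by (rule quadratic_inequality_bound) (use lam in \<open>auto simp: A_def B_def K_def\<close>)
    moreover have "A < e'" using lam x uq1 by (simp add: A_def dist_norm)
    moreover have "B \<le> e'\<^sup>2" using lam uq2 by (simp add: B_def)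
    then have "sqrt B \<le> e'" using e' by (intro real_le_lsqrt) auto
    ultimately have "norm (u - prox lam f x) < 2 * e'" by linarith
    moreover have "dist (prox lam f x) q \<le> norm (u - prox lam f x) + norm (u - q)"
      using dist_triangle[of "prox lam f x" q u] by (simp add: dist_norm norm_minus_commute)
    ultimately show ?thesis using uq1 e' by (simp add: e'_def)
  qed
  show "eventually (\<lambda>z. dist (case z of (lam, x) \<Rightarrow> prox lam f x)
          (closest_point (closure (ereal_dom f)) xbar) < e) (at_right 0 \<times>\<^sub>F nhds xbar)"
    unfolding eventually_prod_filter
    using evl evx close by (intro exI conjI) (auto simp: q_def)
qed

end
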